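(* Let $n\ge 3$ be an integer whose smallest prime divisor is at least $7$. Then $\operatorname{ext}_D(C_n)=4$.
   Context: $C_n$ is the cycle on $n$ vertices, with automorphism group the dihedral group acting on $V(C_n)$. A vertex coloring is distinguishing if the only automorphism preserving all colors is the identity; $D(C_n)$ is the least number of colors admitting a distinguishing coloring (it equals $2$ for $n\ge 6$). A set $S\subseteq V(C_n)$ is a fixing set if every non-identity automorphism moves some element of $S$. $\operatorname{ext}_D(C_n)$ is the minimum $m$ such that for every fixing set $W\subseteq V(C_n)$ with $|W|\ge m$, every coloring $V(C_n)\setminus W\to\{1,\dots,D(C_n)\}$ extends to a distinguishing $D(C_n)$-coloring of $V(C_n)$. *)

theory Defs
  imports
    "HOL-Computational_Algebra.Primes"
    "HOL-Combinatorics.Permutations"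
    "HOL-Library.FuncSet"
begin

text \<open>
  A finite simple graph is given by its vertex set \<open>V\<close> and its set \<open>E\<close> of edges,
  each edge being a two-element set of vertices.
\<close>

text \<open>
  Because \<^const>\<open>permutes\<close> forces an automorphism to be the identity outside \<open>V\<close>,
  the identity automorphism is exactly \<^const>\<open>id\<close>.
\<close>

definition graph_aut :: "'a set \<Rightarrow> 'a set set \<Rightarrow> ('a \<Rightarrow> 'a) set" where
  "graph_aut V E =
     {f. f permutes V \<and> (\<forall>u\<in>V. \<forall>v\<in>V. {f u, f v} \<in> E \<longleftrightarrow> {u, v} \<in> E)}"

definition distinguishing :: "'a set \<Rightarrow> 'a set set \<Rightarrow> ('a \<Rightarrow> nat) \<Rightarrow> bool" where
  "distinguishing V E c \<longleftrightarrow>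
     (\<forall>f\<in>graph_aut V E. (\<forall>v\<in>V. c (f v) = c v) \<longrightarrow> f = id)"

text \<open>For finite \<open>V\<close> an injective coloring is distinguishing, so the minimum exists.\<close>

definition dist_number :: "'a set \<Rightarrow> 'a set set \<Rightarrow> nat" where
  "dist_number V E = (LEAST k. \<exists>c\<in>V \<rightarrow> {1..k}. distinguishing V E c)"

definition fixing_set :: "'a set \<Rightarrow> 'a set set \<Rightarrow> 'a set \<Rightarrow> bool" where
  "fixing_set V E S \<longleftrightarrow>
     S \<subseteq> V \<and> (\<forall>f\<in>graph_aut V E. f \<noteq> id \<longrightarrow> (\<exists>v\<in>S. f v \<noteq> v))"

definition extends_distinguishing :: "'a set \<Rightarrow> 'a set set \<Rightarrow> 'a set \<Rightarrow> bool" where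
  "extends_distinguishing V E W \<longleftrightarrow>
     (\<forall>c \<in> V - W \<rightarrow> {1..dist_number V E}.
        \<exists>d \<in> V \<rightarrow> {1..dist_number V E}.
          (\<forall>v \<in> V - W. d v = c v) \<and> distinguishing V E d)"

text \<open>For finite \<open>V\<close> the value \<open>m = card V + 1\<close> is vacuously admissible, so the minimum exists.\<close>

definition ext_D :: "'a set \<Rightarrow> 'a set set \<Rightarrow> nat" where
  "ext_D V E =
     (LEAST m. \<forall>W. fixing_set V E W \<and> card W \<ge> m \<longrightarrow> extends_distinguishing V E W)"

text \<open>The graph with these vertices and edges is the cycle on \<open>n\<close> vertices only for \<open>n \<ge> 3\<close>.\<close>

definition cycle_verts :: "nat \<Rightarrow> nat set" where
  "cycle_verts n = {0..<n}"

definition cycle_edges :: "nat \<Rightarrow> nat set set" where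
  "cycle_edges n = {{i, (i + 1) mod n} | i. i < n}"

end

theory Submission
  imports Defs
begin

text \<open>
  For odd \<open>n\<close> the automorphisms of the cycle are the maps \<open>x \<mapsto> k \<plusminus> x\<close> of the integers modulo \<open>n\<close>,
  so a 2-coloring fails to be distinguishing iff it is invariant under a nontrivial rotation or
  under a reflection. Suppose that all colorings that agree outside a set \<open>W\<close> of at least four
  vertices are symmetric in this sense. At most one of them is rotational. Hence some coloring
  \<open>c\<close> and its flip at some \<open>w \<in> W\<close> have reflections with different axes, and composing the
  two reflections gives a translation \<open>t\<close> that changes the color at only two places: up to
  translates by \<open>t\<close>, one of the two colorings is an arc. Flipping a vertex of an arc leaves a
  symmetric coloring only if the vertex is one of the four next to the ends of the arc or the
  center. So \<open>W\<close> contains both vertices next to one end, and flipping one of them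
  moves the arc to a place where the other is no longer admissible; for arcs (or complements of arcs) of
  length 2 one lengthens by one first. The arguments need that no multiple \<open>j t\<close> with
  \<open>1 \<le> j \<le> 6\<close> vanishes. In the other direction the vertices \<open>0, 1, 2\<close> form a fixing set, and
  every 2-coloring that is constant elsewhere is symmetric.
\<close>

section \<open>Two-colorings of the integers modulo \<open>n\<close>\<close>

locale seven_rough =
  fixes n :: int
  assumes torsion: "n dvd j * t \<Longrightarrow> 1 \<le> j \<Longrightarrow> j \<le> 6 \<Longrightarrow> n dvd t"
begin

abbreviation congr (infix "\<simeq>" 50) where "x \<simeq> y \<equiv> n dvd (x - y)"

lemma congr_sym: "x \<simeq> y \<Longrightarrow> y \<simeq> x"
  by (simp add: dvd_diff_commute)

lemma congr_trans: "x \<simeq> y \<Longrightarrow> y \<simeq> z \<Longrightarrow> x \<simeq> z"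
  by algebra

lemma congr_cong: "x \<simeq> y \<Longrightarrow> z \<simeq> x \<longleftrightarrow> z \<simeq> y"
  using congr_sym congr_trans by blast

text \<open>The seven points \<open>x + j * u\<close> with \<open>j\<close> from 0 to 6 are pairwise
  incongruent, since two indices differ by at most 6; so six classes cannot hold them all.\<close>

lemma orbit_escapes:
  assumes "\<not> n dvd u" "finite S" "card S < 7"
  shows "\<exists>j::nat. \<forall>s\<in>S. \<not> x + int j * u \<simeq> s"
proof (rule ccontr)
  assume "\<not> ?thesis"
  then obtain g where g: "\<And>j::nat. g j \<in> S \<and> x + int j * u \<simeq> g j"
    by metis
  have neq: "g i \<noteq> g j" if "i < j" "j < 7" for i j
  proof
    assume "g i = g j"
    then have "x + int i * u \<simeq> g j" "x + int j * u \<simeq> g j" using g by metis+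
    then have "n dvd (int j - int i) * u" by algebra
    then show False using torsion[of "int j - int i" u] assms(1) that by auto
  qed
  have "inj_on g {..<7}"
    by (rule inj_onI) (metis lessThan_iff linorder_neqE_nat neq)
  then have "card {..<7::nat} \<le> card S"
    using g assms(2) by (intro card_inj_on_le) auto
  then show False using assms(3) by simp
qed

text \<open>Changing the whole residue class of \<open>w\<close> keeps a periodic coloring
  periodic.\<close>

definition flip :: "(int \<Rightarrow> bool) \<Rightarrow> int \<Rightarrow> int \<Rightarrow> bool" where
  "flip c w = (\<lambda>x. if x \<simeq> w then \<not> c x else c x)"

definition periodic :: "(int \<Rightarrow> bool) \<Rightarrow> bool" where
  "periodic c \<longleftrightarrow> (\<forall>x y. x \<simeq> y \<longrightarrow> c x = c y)"

definition rotational :: "(int \<Rightarrow> bool) \<Rightarrow> bool" where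
  "rotational c \<longleftrightarrow> (\<exists>u. \<not> n dvd u \<and> (\<forall>x. c (x + u) = c x))"

definition reflective :: "(int \<Rightarrow> bool) \<Rightarrow> bool" where
  "reflective c \<longleftrightarrow> (\<exists>k. \<forall>x. c (k - x) = c x)"

text \<open>
  Stepping by \<open>t\<close>, the color changes only between \<open>p\<close> and \<open>p + t\<close> and between \<open>r\<close> and \<open>r + t\<close>;
  the last two conditions say that the arc and its complement have length at least 2.
\<close>

definition arc :: "int \<Rightarrow> int \<Rightarrow> int \<Rightarrow> (int \<Rightarrow> bool) \<Rightarrow> bool" where
  "arc t p r c \<longleftrightarrow> (\<forall>x. c (x + t) \<noteq> c x \<longleftrightarrow> x \<simeq> p \<or> x \<simeq> r) \<and>
     \<not> p \<simeq> r \<and> \<not> p + t \<simeq> r \<and> \<not> r + t \<simeq> p"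

lemma flip_congr: "w \<simeq> w' \<Longrightarrow> flip c w = flip c w'"
  unfolding flip_def using congr_cong by (intro ext) auto

lemma periodic_flip: "periodic c \<Longrightarrow> periodic (flip c w)"
  unfolding periodic_def flip_def by (metis congr_sym congr_trans)

lemma invariant_multiple:
  assumes "\<And>x. c (x + u) = c x"
  shows "c (x + int j * u) = c x"
proof (induction j)
  case (Suc j)
  have "x + int (Suc j) * u = x + int j * u + u" by (simp add: algebra_simps)
  then show ?case using assms Suc.IH by metis
qed simp

text \<open>Walk around a parallelogram whose sides are multiples of a period of \<open>f\<close>
  and of a period of \<open>g\<close>: its corners other than \<open>x\<close> can be kept outside
  \<open>D\<close>, where \<open>f\<close> and \<open>g\<close> agree. The second multiple has to
  avoid \<open>D\<close> and a translate of \<open>D\<close>, at most six classes.\<close>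

lemma rotational_unique:
  assumes "rotational f" "rotational g" "finite D" "card D \<le> 3"
    and agree: "\<And>x. \<forall>d\<in>D. \<not> x \<simeq> d \<Longrightarrow> f x = g x"
  shows "f = g"
proof
  fix x
  obtain s where s: "\<not> n dvd s" "\<And>x. f (x + s) = f x" using assms(1) by (auto simp: rotational_def)
  obtain t where t: "\<not> n dvd t" "\<And>x. g (x + t) = g x" using assms(2) by (auto simp: rotational_def)
  obtain i where i: "\<forall>d\<in>D. \<not> x + int i * s \<simeq> d"
    using orbit_escapes[OF s(1) assms(3)] assms(4) by fastforce
  let ?S = "D \<union> (\<lambda>d. d - int i * s) ` D"
  have "card ?S \<le> card D + card D"
    using card_Un_le[of D] card_image_le[OF assms(3)] by (meson add_left_mono le_trans)
  then obtain j where j: "\<forall>d\<in>?S. \<not> x + int j * t \<simeq> d"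
    using orbit_escapes[OF t(1), of ?S x] assms(3,4) by fastforce
  have j2: "\<not> x + int j * t + int i * s \<simeq> d" if "d \<in> D" for d
  proof -
    have "\<not> x + int j * t \<simeq> d - int i * s" using j that by blast
    then show ?thesis by (simp add: algebra_simps)
  qed
  note fs = invariant_multiple[where c = f and u = s, OF s(2)]
  note gt = invariant_multiple[where c = g and u = t, OF t(2)]
  have "f x = f (x + int i * s)" using fs[of x i] by simp
  also have "\<dots> = g (x + int i * s)" using agree i by blast
  also have "\<dots> = g (x + int i * s + int j * t)" using gt[of "x + int i * s" j] by simp
  also have "\<dots> = f (x + int j * t + int i * s)" using agree j2 by (simp add: algebra_simps)
  also have "\<dots> = f (x + int j * t)" using fs[of "x + int j * t" i] by simp
  also have "\<dots> = g (x + int j * t)" using agree j by blast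
  also have "\<dots> = g x" using gt[of x j] by simp
  finally show "f x = g x" .
qed

section \<open>Arcs and the effect of a flip on them\<close>

lemma arc_commute: "arc t p r c \<Longrightarrow> arc t r p c"
  unfolding arc_def using congr_sym by blast

lemma arc_step_nonzero:
  assumes "periodic c" "arc t p r c"
  shows "\<not> n dvd t"
proof
  assume "n dvd t"
  then have "c (p + t) = c p" using assms(1) unfolding periodic_def by simp
  moreover have "c (p + t) \<noteq> c p"
    using assms(2) unfolding arc_def by (metis diff_self dvd_0_right)
  ultimately show False by simp
qed

text \<open>A flip at \<open>w\<close> toggles the jump into \<open>w\<close> and the jump out of
  \<open>w\<close>; a nonzero step keeps the two apart, so they do not cancel.\<close>

lemma flip_jump:
  assumes "\<not> n dvd t"
  shows "flip c w (x + t) \<noteq> flip c w x \<longleftrightarrow>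
    ((c (x + t) \<noteq> c x) \<noteq> (x \<simeq> w \<or> x \<simeq> w - t))"
proof -
  have "x + t \<simeq> w \<longleftrightarrow> x \<simeq> w - t" by (simp add: algebra_simps)
  moreover have "\<not> (x \<simeq> w \<and> x \<simeq> w - t)"
  proof
    assume "x \<simeq> w \<and> x \<simeq> w - t"
    then have "n dvd t" by algebra
    then show False using assms by blast
  qed
  ultimately show ?thesis unfolding flip_def by auto
qed

lemma double_cancel: "2 * x \<simeq> 2 * y \<Longrightarrow> x \<simeq> y"
  using torsion[of 2 "x - y"] by (simp add: algebra_simps)

text \<open>Points exchanged by the reflection have sum \<open>m\<close> modulo \<open>n\<close>;
  equating the sums of the two pairs eliminates \<open>m\<close>. The alternatives are the three
  ways to split four points into pairs.\<close>

lemma reflected_four_points: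
  assumes X: "X = {x. x \<simeq> p \<or> x \<simeq> r \<or> x \<simeq> w \<or> x \<simeq> v}"
    and ref: "\<And>x. x \<in> X \<Longrightarrow> m - x \<in> X"
    and d: "\<not> p \<simeq> r" "\<not> p \<simeq> w" "\<not> p \<simeq> v" "\<not> r \<simeq> w" "\<not> r \<simeq> v" "\<not> w \<simeq> v"
  shows "w + v \<simeq> p + r \<or> w + p \<simeq> v + r \<or> w + r \<simeq> v + p"
proof -
  have fix_unique: "x \<simeq> y" if "m - x \<simeq> x" "m - y \<simeq> y" for x y
  proof -
    have "2 * x \<simeq> 2 * y" using that by algebra
    then show ?thesis by (rule double_cancel)
  qed
  have inj: "x \<simeq> y" if "m - x \<simeq> z" "m - y \<simeq> z" for x y z
    using that by algebra
  have swap: "m - x \<simeq> y \<longleftrightarrow> m - y \<simeq> x" for x y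
    using congr_sym[of x "m - y"] congr_sym[of "m - y" x] by (simp add: algebra_simps)
  have sum: "x + y \<simeq> z + u" if "m - x \<simeq> y" "m - z \<simeq> u" for x y z u
    using that by algebra
  have row: "m - x \<simeq> p \<or> m - x \<simeq> r \<or> m - x \<simeq> w \<or> m - x \<simeq> v" if "x \<in> {p, r, w, v}" for x
    using ref[of x] that unfolding X by auto
  \<comment> \<open>\<open>F\<close> is the graph of an involution on four points with at most one fixed point,
    hence a perfect matching.\<close>
  define F where "F x y \<longleftrightarrow> m - x \<simeq> y" for x y
  have "F p p \<or> F p r \<or> F p w \<or> F p v" "F r p \<or> F r r \<or> F r w \<or> F r v"
    "F w p \<or> F w r \<or> F w w \<or> F w v" "F v p \<or> F v r \<or> F v w \<or> F v v"
    using row[of p] row[of r] row[of w] row[of v] unfolding F_def by blast+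
  moreover have "F r p = F p r" "F w p = F p w" "F v p = F p v"
    "F w r = F r w" "F v r = F r v" "F v w = F w v"
    using swap unfolding F_def by simp_all
  moreover have "\<not> (F p x \<and> F r x)" "\<not> (F p x \<and> F w x)" "\<not> (F p x \<and> F v x)"
    "\<not> (F r x \<and> F w x)" "\<not> (F r x \<and> F v x)" "\<not> (F w x \<and> F v x)" for x
    using inj d unfolding F_def by blast+
  moreover have "\<not> (F p p \<and> F r r)" "\<not> (F p p \<and> F w w)" "\<not> (F p p \<and> F v v)"
    "\<not> (F r r \<and> F w w)" "\<not> (F r r \<and> F v v)" "\<not> (F w w \<and> F v v)"
    using fix_unique d unfolding F_def by blast+
  ultimately have "F w v \<and> F p r \<or> F w p \<and> F v r \<or> F w r \<and> F v p"
    by metis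
  then show ?thesis using sum unfolding F_def by blast
qed

text \<open>Away from the ends, the flip leaves exactly the four jumps \<open>p\<close>,
  \<open>r\<close>, \<open>w\<close>, \<open>w - t\<close>. A rotation would need at least seven,
  and a reflection pairs them up. Pairing \<open>w\<close> with \<open>w - t\<close> puts
  \<open>w\<close> at the center; the other pairings mean an arc or complement of length 1.\<close>

lemma flip_arc_symmetric:
  assumes c: "periodic c" "arc t p r c"
    and sym: "rotational (flip c w) \<or> reflective (flip c w)"
  shows "w \<simeq> p \<or> w \<simeq> p + t \<or> w \<simeq> r \<or> w \<simeq> r + t \<or> 2 * w \<simeq> p + r + t"
proof (rule ccontr)
  assume no: "\<not> ?thesis"
  have t: "\<not> n dvd t" using arc_step_nonzero[OF c] .
  have a: "\<And>x. c (x + t) \<noteq> c x \<longleftrightarrow> x \<simeq> p \<or> x \<simeq> r"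
    and pr: "\<not> p \<simeq> r" "\<not> p + t \<simeq> r" "\<not> r + t \<simeq> p"
    using c(2) unfolding arc_def by auto
  define X where "X = {x. x \<simeq> p \<or> x \<simeq> r \<or> x \<simeq> w \<or> x \<simeq> w - t}"
  have d: "\<not> p \<simeq> w" "\<not> p \<simeq> w - t" "\<not> r \<simeq> w" "\<not> r \<simeq> w - t" "\<not> w \<simeq> w - t"
    using no t congr_sym[of p w] congr_sym[of r w] congr_sym[of p "w - t"] congr_sym[of r "w - t"]
    by (auto simp: algebra_simps)
  have X: "flip c w (x + t) \<noteq> flip c w x \<longleftrightarrow> x \<in> X" for x
    unfolding flip_jump[OF t] a X_def using d congr_sym congr_trans by blast
  from sym show False
  proof
    assume "rotational (flip c w)"
    then obtain u where u: "\<not> n dvd u" "\<And>x. flip c w (x + u) = flip c w x"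
      unfolding rotational_def by blast
    have "x + u \<in> X \<longleftrightarrow> x \<in> X" for x
      using X u(2) by (metis add.assoc add.commute)
    then have "w + int j * u \<in> X" for j
      using invariant_multiple[of "\<lambda>x. x \<in> X" u w j] by (simp add: X_def)
    moreover have "card {p, r, w, w - t} < 7"
      by (intro le_less_trans[OF card_length[of "[p, r, w, w - t]", simplified]]) simp
    ultimately show False
      using orbit_escapes[OF u(1), of "{p, r, w, w - t}" w] by (auto simp: X_def)
  next
    assume "reflective (flip c w)"
    then obtain k where k: "\<And>x. flip c w (k - x) = flip c w x"
      unfolding reflective_def by blast
    \<comment> \<open>The reflection reverses steps: the one between \<open>x\<close> and
      \<open>x + t\<close> becomes the one that starts at \<open>k - t - x\<close>.\<close>
    have "k - t - x \<in> X" if "x \<in> X" for x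
      using that k[of x] k[of "x + t"] unfolding X[symmetric] by (simp add: algebra_simps)
    from reflected_four_points[OF X_def this pr(1) d]
    have "2 * w \<simeq> p + r + t \<or> p + t \<simeq> r \<or> r + t \<simeq> p"
      by (simp add: algebra_simps)
    then show False using no pr by blast
  qed
qed


text \<open>The vertex \<open>p\<close> ends the run from \<open>r + t\<close> to \<open>p\<close>.
  Flipping it shortens this run by one, and \<open>long\<close> excludes that the run has length
  2.\<close>

lemma flip_arc_end:
  assumes c: "periodic c" "arc t p r c" and long: "\<not> p \<simeq> r + 2 * t"
  shows "arc t (p - t) r (flip c p)"
proof -
  have t: "\<not> n dvd t" using arc_step_nonzero[OF c] .
  have pr: "\<not> p \<simeq> r" "\<not> p + t \<simeq> r" "\<not> r + t \<simeq> p"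
    using c(2) unfolding arc_def by auto
  have "flip c p (x + t) \<noteq> flip c p x \<longleftrightarrow> x \<simeq> p - t \<or> x \<simeq> r" for x
  proof -
    have "\<not> (x \<simeq> p \<and> x \<simeq> r)" using pr(1) congr_sym congr_trans by blast
    moreover have "\<not> (x \<simeq> p - t \<and> x \<simeq> r)" "\<not> (x \<simeq> p \<and> x \<simeq> p - t)"
    proof -
      show "\<not> (x \<simeq> p - t \<and> x \<simeq> r)"
      proof
        assume "x \<simeq> p - t \<and> x \<simeq> r"
        then have "r + t \<simeq> p" by algebra
        then show False using pr by blast
      qed
      show "\<not> (x \<simeq> p \<and> x \<simeq> p - t)"
      proof
        assume "x \<simeq> p \<and> x \<simeq> p - t"
        then have "n dvd t" by algebra
        then show False using t by blast
      qed
    qed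
    ultimately show ?thesis
      using c(2) unfolding flip_jump[OF t] arc_def by blast
  qed
  moreover have "\<not> p - t \<simeq> r"
    using pr(3) congr_sym[of "p - t" r] by (auto simp: algebra_simps)
  moreover have "\<not> r + t \<simeq> p - t"
    using long congr_sym[of "r + t" "p - t"] by (auto simp: algebra_simps)
  ultimately show ?thesis using pr(1) unfolding arc_def by auto
qed

text \<open>A jump is recorded where its step starts, so stepping backwards shifts both positions by
  \<open>t\<close>. This reduces \<open>flip_arc_start\<close> to
  \<open>flip_arc_end\<close>.\<close>

lemma arc_reverse:
  assumes "arc t p r c"
  shows "arc (- t) (p + t) (r + t) c"
proof -
  have "c (x + - t) \<noteq> c x \<longleftrightarrow> x \<simeq> p + t \<or> x \<simeq> r + t" for x
  proof -
    have "c (x - t + t) \<noteq> c (x - t) \<longleftrightarrow> x - t \<simeq> p \<or> x - t \<simeq> r"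
      using assms unfolding arc_def by blast
    then show ?thesis by (simp add: algebra_simps) blast
  qed
  moreover have "\<not> p \<simeq> r + t" "\<not> r \<simeq> p + t" "\<not> p \<simeq> r"
    using assms congr_sym unfolding arc_def by blast+
  ultimately show ?thesis unfolding arc_def by simp
qed

lemma flip_arc_start:
  assumes c: "periodic c" "arc t p r c" and long: "\<not> r \<simeq> p + 2 * t"
  shows "arc t (p + t) r (flip c (p + t))"
proof -
  have "\<not> p + t \<simeq> r + t + 2 * - t"
    using long congr_sym[of "p + t" "r - t"] by (auto simp: algebra_simps)
  then have "arc (- t) (p + t - - t) (r + t) (flip c (p + t))"
    using flip_arc_end[OF c(1) arc_reverse[OF c(2)]] by blast
  from arc_reverse[OF this] show ?thesis by (simp add: add.commute)
qed

text \<open>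
  The jumps of \<open>c\<close> along \<open>t\<close> are at \<open>w\<close> and \<open>k' - w\<close>. If the arc so obtained has length 1 on
  one side, then flipping \<open>w\<close> makes that side have length 2.
\<close>

lemma arc_of_reflections:
  assumes c: "periodic c" "\<not> rotational c" and k: "\<And>x. c (k - x) = c x"
    and k': "\<And>x. flip c w (k' - x) = flip c w x"
    and w: "\<not> 2 * w \<simeq> k"
  shows "\<exists>t p r. arc t p r c \<or> arc t p r (flip c w)"
proof -
  \<comment> \<open>As \<open>k - (x + t) = k' - x\<close>, the two reflections compose to a
    translation by \<open>t\<close>. Along it \<open>c\<close> can change only if \<open>x\<close>
    or \<open>k' - x\<close> is in the class of \<open>w\<close>.\<close>
  define t where "t = k - k'"
  have c_cong: "c x = c y" if "x \<simeq> y" for x y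
    using c(1) that unfolding periodic_def by blast
  have t: "\<not> n dvd t"
  proof
    assume "n dvd t"
    then have "c (k' - w) = c (k - w)"
      unfolding t_def by (intro c_cong) (simp add: dvd_diff_commute)
    then have "c (k' - w) = c w" using k by simp
    moreover have "flip c w w = (\<not> c w)" unfolding flip_def by simp
    ultimately have "k' - w \<simeq> w"
      using k'[of w] unfolding flip_def by (auto split: if_splits)
    with \<open>n dvd t\<close> have "2 * w \<simeq> k" unfolding t_def by algebra
    then show False using w by blast
  qed
  have jumps: "c (x + t) \<noteq> c x \<longleftrightarrow> (x \<simeq> w) \<noteq> (x \<simeq> k' - w)" for x
  proof -
    have "c (x + t) = c (k' - x)" using k[of "x + t"] by (simp add: t_def algebra_simps)
    moreover have "k' - x \<simeq> w \<longleftrightarrow> x \<simeq> k' - w"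
      using congr_sym[of "k' - x" w] congr_sym[of x "k' - w"] dvd_diff_commute[of n "k' - x" w]
      by (simp add: algebra_simps)
    ultimately show ?thesis using k'[of x] unfolding flip_def by (auto split: if_splits)
  qed
  have kw: "\<not> w \<simeq> k' - w"
  proof
    assume "w \<simeq> k' - w"
    then have "c (x + t) = c x" for x using jumps congr_cong by blast
    then show False using c(2) t unfolding rotational_def by blast
  qed
  have jumps2: "c (x + t) \<noteq> c x \<longleftrightarrow> x \<simeq> w \<or> x \<simeq> k' - w" for x
    using jumps kw congr_sym congr_trans by blast
  have kw2: "\<not> k' - w + t \<simeq> w"
  proof
    assume "k' - w + t \<simeq> w"
    then have "2 * w \<simeq> k" unfolding t_def by algebra
    then show False using w by blast
  qed
  show ?thesis
  proof (cases "w + t \<simeq> k' - w")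
    case False
    then have "arc t w (k' - w) c" unfolding arc_def using jumps2 kw kw2 by blast
    then show ?thesis by blast
  next
    case True
    have "flip c w (x + t) \<noteq> flip c w x \<longleftrightarrow> x \<simeq> k' - w \<or> x \<simeq> w - t" for x
    proof -
      have "\<not> (x \<simeq> w \<and> x \<simeq> k' - w)" using kw congr_sym congr_trans by blast
      moreover have "\<not> (x \<simeq> w \<and> x \<simeq> w - t)"
      proof
        assume "x \<simeq> w \<and> x \<simeq> w - t"
        then have "n dvd t" by algebra
        then show False using t by blast
      qed
      moreover have "\<not> (x \<simeq> k' - w \<and> x \<simeq> w - t)"
      proof
        assume "x \<simeq> k' - w \<and> x \<simeq> w - t"
        then have "k' - w + t \<simeq> w" by algebra
        then show False using kw2 by blast
      qed
      ultimately show ?thesis unfolding flip_jump[OF t] jumps2 by blast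
    qed
    moreover have "\<not> k' - w \<simeq> w - t"
      using kw2 by (simp add: algebra_simps)
    \<comment> \<open>Otherwise an arc of length 2 and a complement of length 1 would make up an
      orbit of \<open>t\<close> with three points.\<close>
    moreover have "\<not> k' - w + t \<simeq> w - t"
    proof
      assume "k' - w + t \<simeq> w - t"
      with True have "n dvd 3 * t" by algebra
      then show False using torsion[of 3 t] t by simp
    qed
    moreover have "\<not> w - t + t \<simeq> k' - w" using kw by simp
    ultimately have "arc t (k' - w) (w - t) (flip c w)" unfolding arc_def by blast
    then show ?thesis by blast
  qed
qed

end

section \<open>Families of symmetric colorings closed under flips at four or more vertices\<close>

locale symmetric_cube = seven_rough +
  fixes C :: "(int \<Rightarrow> bool) set" and W :: "int set"
  assumes per: "c \<in> C \<Longrightarrow> periodic c"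
    and closed: "c \<in> C \<Longrightarrow> w \<in> W \<Longrightarrow> flip c w \<in> C"
    and symmetric: "c \<in> C \<Longrightarrow> rotational c \<or> reflective c"
    and finite_W: "finite W" and card_W: "4 \<le> card W"
    and distinct: "w \<in> W \<Longrightarrow> w' \<in> W \<Longrightarrow> w \<simeq> w' \<Longrightarrow> w = w'"
begin

definition free :: "int \<Rightarrow> bool" where
  "free x \<longleftrightarrow> (\<exists>w\<in>W. w \<simeq> x)"

lemma flip_free: "c \<in> C \<Longrightarrow> free x \<Longrightarrow> flip c x \<in> C"
  unfolding free_def using closed flip_congr by metis

lemma card_le_1:
  assumes "\<And>w w'. w \<in> W \<Longrightarrow> w' \<in> W \<Longrightarrow> P w \<Longrightarrow> P w' \<Longrightarrow> w \<simeq> w'"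
  shows "card {w \<in> W. P w} \<le> 1"
  using assms distinct finite_W
  by (subst One_nat_def, subst card_le_Suc0_iff_eq) auto

lemma card_halves_le_1: "card {w \<in> W. 2 * w \<simeq> y} \<le> 1"
proof (rule card_le_1)
  fix w w' assume "2 * w \<simeq> y" "2 * w' \<simeq> y"
  then have "2 * w \<simeq> 2 * w'" using congr_sym congr_trans by blast
  then show "w \<simeq> w'" by (rule double_cancel)
qed

text \<open>By \<open>flip_arc_symmetric\<close>, \<open>W\<close> contains only vertices next to
  the ends and the center. If each end had at most one free neighbor, \<open>W\<close> would have at
  most three elements.\<close>

lemma arc_ends_free:
  assumes "c \<in> C" "arc t p r c"
  shows "free p \<and> free (p + t) \<or> free r \<and> free (r + t)"
proof (rule ccontr)
  assume no: "\<not> ?thesis"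
  define a where "a = (if free p then p else p + t)"
  define b where "b = (if free r then r else r + t)"
  let ?cls = "\<lambda>y. {w \<in> W. w \<simeq> y}" and ?Z = "{w \<in> W. 2 * w \<simeq> p + r + t}"
  have "W \<subseteq> ?cls a \<union> (?cls b \<union> ?Z)"
  proof
    fix w assume w: "w \<in> W"
    then have "w \<simeq> p \<or> w \<simeq> p + t \<or> w \<simeq> r \<or> w \<simeq> r + t \<or> 2 * w \<simeq> p + r + t"
      using flip_arc_symmetric[OF per assms(2)] assms(1) closed symmetric by blast
    moreover have "w \<simeq> p \<or> w \<simeq> p + t \<Longrightarrow> w \<simeq> a" "w \<simeq> r \<or> w \<simeq> r + t \<Longrightarrow> w \<simeq> b"
      using no w unfolding a_def b_def free_def by auto
    ultimately show "w \<in> ?cls a \<union> (?cls b \<union> ?Z)" using w by blast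
  qed
  then have "card W \<le> card (?cls a \<union> (?cls b \<union> ?Z))"
    using finite_W by (intro card_mono) auto
  also have "\<dots> \<le> card (?cls a) + (card (?cls b) + card ?Z)"
    by (meson add_left_mono card_Un_le le_trans)
  finally have "card W \<le> card (?cls a) + (card (?cls b) + card ?Z)" .
  moreover have "card (?cls a) \<le> 1" "card (?cls b) \<le> 1"
    by (rule card_le_1, use congr_sym congr_trans in blast)+
  moreover have "card ?Z \<le> 1" by (rule card_halves_le_1)
  ultimately show False using card_W by linarith
qed

text \<open>If \<open>p\<close> and \<open>p + t\<close> are free, flipping \<open>p\<close> moves
  that end one step back. Then \<open>p + t\<close> is no longer next to an end, and it is the
  center only if \<open>r\<close> is \<open>p + 2 * t\<close>.\<close>

lemma long_arc_impossible:
  assumes "c \<in> C" "arc t p r c" and long: "\<not> r \<simeq> p + 2 * t" "\<not> p \<simeq> r + 2 * t"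
  shows False
proof -
  have *: False
    if a: "arc t p r c" "\<not> r \<simeq> p + 2 * t" "\<not> p \<simeq> r + 2 * t"
      and free: "free p" "free (p + t)" for p r
  proof -
    have t: "\<not> n dvd t" using arc_step_nonzero[OF per] assms(1) a(1) by blast
    let ?d = "flip c p"
    have "arc t (p - t) r ?d" "?d \<in> C"
      using flip_arc_end[OF per] flip_free assms(1) a free by blast+
    then have "p + t \<simeq> p - t \<or> p + t \<simeq> p - t + t \<or> p + t \<simeq> r \<or> p + t \<simeq> r + t \<or>
        2 * (p + t) \<simeq> p - t + r + t"
      using flip_arc_symmetric[OF per] flip_free free(2) symmetric by metis
    moreover have "\<not> p + t \<simeq> p - t" using t torsion[of 2 t] by auto
    moreover have "\<not> p + t \<simeq> p - t + t" using t by simp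
    moreover have "\<not> p + t \<simeq> r" "\<not> p + t \<simeq> r + t" using a(1) unfolding arc_def by auto
    moreover have "\<not> 2 * (p + t) \<simeq> p - t + r + t"
      using a(2) congr_sym[of "p + 2 * t" r] by (auto simp: algebra_simps)
    ultimately show False by blast
  qed
  show False
    using arc_ends_free[OF assms(1,2)] *[OF assms(2-4)] *[OF arc_commute[OF assms(2)] long(2,1)]
    by blast
qed

text \<open>What remains is a run of length 2, from \<open>p + t\<close> to \<open>r\<close>. One of
  its outer neighbors \<open>p\<close> and \<open>r + t\<close> is free, and flipping that one gives
  a run of length 3, to which \<open>long_arc_impossible\<close> applies.\<close>

lemma arc_impossible:
  assumes "c \<in> C" "arc t p r c"
  shows False
proof -
  have *: False if a: "arc t p r c" and len: "r \<simeq> p + 2 * t" for p r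
  proof -
    have t: "\<not> n dvd t" using arc_step_nonzero[OF per] assms(1) a by blast
    \<comment> \<open>The flip shortens the complement, so it must have length neither 2 nor 3;
      these lengths would give orbits of \<open>t\<close> with four or five points.\<close>
    have short: "\<not> p \<simeq> r + 2 * t"
    proof
      assume "p \<simeq> r + 2 * t"
      with len have "n dvd 4 * t" by algebra
      then show False using t torsion[of 4 t] by simp
    qed
    have long: "\<not> p \<simeq> r + 3 * t"
    proof
      assume "p \<simeq> r + 3 * t"
      with len have "n dvd 5 * t" by algebra
      then show False using t torsion[of 5 t] by simp
    qed
    have pr: "\<not> r \<simeq> p + t" "\<not> p \<simeq> r"
      using a congr_sym unfolding arc_def by blast+
    consider "free p" | "free (r + t)" using arc_ends_free[OF assms(1) a] by blast
    then show False
    proof cases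
      case 1
      have "arc t (p - t) r (flip c p)"
        using flip_arc_end[OF per] assms(1) a short by blast
      then show False
        using long_arc_impossible[of "flip c p" t "p - t" r] flip_free[OF assms(1) 1] pr long
        by (simp add: algebra_simps)
    next
      case 2
      have "arc t (r + t) p (flip c (r + t))"
        using flip_arc_start[OF per] assms(1) arc_commute[OF a] short by blast
      then show False
        using long_arc_impossible[of "flip c (r + t)" t "r + t" p] flip_free[OF assms(1) 2] pr long
        by (simp add: algebra_simps)
    qed
  qed
  show False
    using long_arc_impossible[OF assms] *[OF assms(2)] *[OF arc_commute[OF assms(2)]] by blast
qed

text \<open>By \<open>rotational_unique\<close>, \<open>c0\<close> and one of its flips are not both
  rotational, which yields \<open>c\<close>, and at most one flip of \<open>c\<close> is rotational.
  At most one vertex of \<open>W\<close> lies on the axis of \<open>c\<close>, so some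
  \<open>w\<close> avoids both exceptions and yields an arc.\<close>

lemma C_empty: "C = {}"
proof (rule ccontr)
  assume "C \<noteq> {}"
  then obtain c0 where c0: "c0 \<in> C" by blast
  have agree: "flip c w x = c x" if "\<not> x \<simeq> w" for c w x
    using that unfolding flip_def by simp
  have differ: "flip c w w \<noteq> c w" for c w
    unfolding flip_def by simp
  obtain w0 where w0: "w0 \<in> W" using card_W by fastforce
  have "\<not> (rotational c0 \<and> rotational (flip c0 w0))"
    using rotational_unique[of c0 "flip c0 w0" "{w0}"] agree[of _ w0 c0] differ[of c0 w0] by fastforce
  then obtain c where c: "c \<in> C" "\<not> rotational c"
    using c0 closed w0 by blast
  then obtain k where k: "\<And>x. c (k - x) = c x"
    using symmetric unfolding reflective_def by blast
  let ?R = "{w \<in> W. rotational (flip c w)}" and ?F = "{w \<in> W. 2 * w \<simeq> k}"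
  have "card ?R \<le> 1"
  proof (rule card_le_1)
    fix w w' assume rot: "rotational (flip c w)" "rotational (flip c w')"
    show "w \<simeq> w'"
    proof (rule ccontr)
      assume "\<not> w \<simeq> w'"
      then have "flip c w w \<noteq> flip c w' w" using agree differ by metis
      moreover have "flip c w = flip c w'"
        using rot by (intro rotational_unique[of _ _ "{w, w'}"]) (auto simp: agree card_insert_if)
      ultimately show False by simp
    qed
  qed
  moreover have "card ?F \<le> 1" by (rule card_halves_le_1)
  ultimately have "card (?R \<union> ?F) < card W"
    using card_Un_le[of ?R ?F] card_W by linarith
  then obtain w where w: "w \<in> W" "\<not> rotational (flip c w)" "\<not> 2 * w \<simeq> k"
    using card_mono[of "?R \<union> ?F" W] finite_W by fastforce
  then obtain k' where k': "\<And>x. flip c w (k' - x) = flip c w x"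
    using symmetric closed c(1) unfolding reflective_def by blast
  show False
    using arc_of_reflections[OF per[OF c(1)] c(2) k k' w(3)] arc_impossible c(1) closed w(1)
    by blast
qed

end

section \<open>Automorphisms of the cycle as affine maps\<close>

lemma nat_mod_eq:
  assumes "int n dvd int a - y" "a < n"
  shows "nat (y mod int n) = a"
  using assms by (metis mod_eq_dvd_iff mod_less nat_int of_nat_mod)

lemma cycle_edge_iff:
  assumes "u < n" "v < n"
  shows "{u, v} \<in> cycle_edges n \<longleftrightarrow>
    int n dvd int v - int u - 1 \<or> int n dvd int u - int v - 1"
proof -
  have "y = (x + 1) mod n \<longleftrightarrow> int n dvd int y - int x - 1" if "y < n" for x y
  proof -
    have "y = (x + 1) mod n \<longleftrightarrow> int y mod int n = int (x + 1) mod int n"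
      using that by (metis mod_less of_nat_eq_iff of_nat_mod)
    then show ?thesis by (simp add: mod_eq_dvd_iff algebra_simps)
  qed
  note this[OF assms(1), of v] this[OF assms(2), of u]
  moreover have "{u, v} \<in> cycle_edges n \<longleftrightarrow> v = (u + 1) mod n \<or> u = (v + 1) mod n"
    using assms unfolding cycle_edges_def by (auto simp: doubleton_eq_iff)
  ultimately show ?thesis by blast
qed

text \<open>Numbers from \<open>n\<close> on stay fixed, as \<open>permutes\<close> demands;
  \<open>e = 1\<close> gives the rotations and \<open>e = - 1\<close> the reflections.\<close>

definition affine :: "nat \<Rightarrow> int \<Rightarrow> int \<Rightarrow> nat \<Rightarrow> nat" where
  "affine n k e v = (if v < n then nat ((k + e * int v) mod int n) else v)"

lemma affine_aut:
  assumes "n > 0" "e \<in> {1, - 1}"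
  shows "affine n k e \<in> graph_aut (cycle_verts n) (cycle_edges n)"
proof -
  let ?f = "affine n k e"
  have lt: "?f v < n" if "v < n" for v
    using that unfolding affine_def by (simp add: nat_less_iff)
  have cong: "int n dvd int (?f v) - (k + e * int v)" if "v < n" for v
    using that unfolding affine_def by (simp flip: mod_eq_dvd_iff)
  have diff: "int n dvd int (?f v) - int (?f u) - e * (int v - int u)" if "u < n" "v < n" for u v
    using cong[OF that(1)] cong[OF that(2)] by algebra
  have "inj_on ?f {0..<n}"
  proof (rule inj_onI)
    fix u v assume uv: "u \<in> {0..<n}" "v \<in> {0..<n}" "?f u = ?f v"
    then have "int n dvd e * (int v - int u)" using diff[of u v] by simp
    then have "int n dvd int v - int u" using assms(2) by (auto simp: dvd_diff_commute)
    then show "u = v" using uv by (metis atLeastLessThan_iff mod_eq_dvd_iff mod_less of_nat_eq_iff of_nat_mod)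
  qed
  moreover have "?f ` {0..<n} \<subseteq> {0..<n}" using lt by auto
  ultimately have "bij_betw ?f {0..<n} {0..<n}"
    by (simp add: bij_betw_def endo_inj_surj)
  then have "?f permutes {0..<n}"
    by (rule bij_imp_permutes) (simp add: affine_def)
  moreover have "{?f u, ?f v} \<in> cycle_edges n \<longleftrightarrow> {u, v} \<in> cycle_edges n"
    if "u < n" "v < n" for u v
  proof -
    have shift: "int n dvd a - 1 \<longleftrightarrow> int n dvd b - 1" if "int n dvd a - b" for a b
      using dvd_add_right_iff[OF that, of "b - 1"] by simp
    have "int n dvd int (?f v) - int (?f u) - 1 \<longleftrightarrow> int n dvd e * (int v - int u) - 1"
      "int n dvd int (?f u) - int (?f v) - 1 \<longleftrightarrow> int n dvd e * (int u - int v) - 1"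
      by (intro shift diff that)+
    then show ?thesis
      unfolding cycle_edge_iff[OF lt[OF that(1)] lt[OF that(2)]] cycle_edge_iff[OF that]
      using assms(2) by auto
  qed
  ultimately show ?thesis unfolding graph_aut_def cycle_verts_def by simp
qed

text \<open>Images of consecutive vertices differ by 1 or -1 modulo \<open>n\<close>. A change of
  sign would give \<open>f (v + 2) = f v\<close>, against injectivity, so all steps equal the
  first.\<close>

lemma aut_affine:
  assumes f: "f \<in> graph_aut (cycle_verts n) (cycle_edges n)" and "n > 0"
  shows "\<exists>k. \<exists>e\<in>{1, - 1}. f = affine n k e"
proof -
  have perm: "f permutes {0..<n}"
    and edge: "\<And>u v. u < n \<Longrightarrow> v < n \<Longrightarrow> {f u, f v} \<in> cycle_edges n \<longleftrightarrow> {u, v} \<in> cycle_edges n"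
    using f unfolding graph_aut_def cycle_verts_def by auto
  have lt: "f v < n" if "v < n" for v
    using permutes_in_image[OF perm, of v] that by simp
  define k where "k = int (f 0)"
  define s where "s v = int (f (v + 1)) - int (f v)" for v
  have step: "int n dvd s v - 1 \<or> int n dvd s v + 1" if "v + 1 < n" for v
  proof -
    have "{f v, f (v + 1)} \<in> cycle_edges n"
      using edge[of v "v + 1"] cycle_edge_iff[of v n "v + 1"] that by simp
    then have "int n dvd s v - 1 \<or> int n dvd - s v - 1"
      using cycle_edge_iff[OF lt lt, of v "v + 1"] that unfolding s_def by auto
    moreover have "- s v - 1 = - (s v + 1)" by simp
    ultimately show ?thesis by (metis dvd_minus_iff)
  qed
  \<comment> \<open>For \<open>n = 1\<close> there is no first step, and either sign will
    do.\<close>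
  have "\<exists>e\<in>{1, - 1}. 1 < n \<longrightarrow> int n dvd s 0 - e"
    using step[of 0] by auto
  then obtain e where e: "e \<in> {1, - 1}" "1 < n \<Longrightarrow> int n dvd s 0 - e"
    by blast
  have same: "int n dvd s v - e" if "v + 1 < n" for v
    using that
  proof (induction v)
    case 0
    then show ?case using e by simp
  next
    case (Suc v)
    show ?case
    proof (rule ccontr)
      assume no: "\<not> ?thesis"
      have "int n dvd s (Suc v) + e" using step[OF Suc.prems] no e(1) by auto
      moreover have "int n dvd s v - e" using Suc by simp
      ultimately have "int n dvd s (Suc v) + s v" by algebra
      then have "int n dvd int (f (Suc (Suc v))) - int (f v)" unfolding s_def by simp
      then have "f (Suc (Suc v)) = f v"
        using lt[of v] lt[of "Suc (Suc v)"] Suc.prems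
        by (metis Suc_eq_plus1 Suc_lessD mod_eq_dvd_iff mod_less of_nat_eq_iff of_nat_mod)
      then show False using permutes_inj[OF perm] by (metis injD n_not_Suc_n Suc_n_not_le_n le_SucI order_refl)
    qed
  qed
  have "int n dvd int (f v) - (k + e * int v)" if "v < n" for v
    using that
  proof (induction v)
    case 0
    then show ?case by (simp add: k_def)
  next
    case (Suc v)
    then have "int n dvd int (f v) - (k + e * int v)" "int n dvd s v - e" using same by auto
    then have "int n dvd (s v + int (f v)) - (k + e * (int v + 1))" by algebra
    then show ?case by (simp add: s_def add.commute)
  qed
  then have "f v = affine n k e v" for v
    using nat_mod_eq[of n "f v"] lt[of v] permutes_not_in[OF perm, of v] unfolding affine_def by auto
  then show ?thesis using e(1) by blast
qed

lemma affine_id: "int n dvd k \<Longrightarrow> affine n k 1 = id"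
  unfolding affine_def by (auto simp: nat_mod_eq)

section \<open>From graph colorings to periodic colorings\<close>

definition lift :: "nat \<Rightarrow> (nat \<Rightarrow> nat) \<Rightarrow> int \<Rightarrow> bool" where
  "lift n d x \<longleftrightarrow> d (nat (x mod int n)) = 1"

context seven_rough
begin

lemma rotational_or_reflective_lift:
  assumes n: "n = int N" "N > 0"
    and d: "\<not> distinguishing (cycle_verts N) (cycle_edges N) d"
  shows "rotational (lift N d) \<or> reflective (lift N d)"
proof -
  obtain f where f: "f \<in> graph_aut (cycle_verts N) (cycle_edges N)" "f \<noteq> id"
    "\<And>v. v < N \<Longrightarrow> d (f v) = d v"
    using d unfolding distinguishing_def cycle_verts_def by auto
  obtain k e where e: "e = 1 \<or> e = - 1" and fa: "f = affine N k e"
    using aut_affine[OF f(1) n(2)] by auto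
  have inv: "lift N d (k + e * x) = lift N d x" for x
  proof -
    let ?v = "nat (x mod int N)"
    have v: "?v < N" "int ?v = x mod int N" using n(2) by (simp_all add: nat_less_iff)
    have "(k + e * (x mod int N)) mod int N = (k + e * x) mod int N"
      by (metis mod_add_right_eq mod_mult_right_eq)
    then have "f ?v = nat ((k + e * x) mod int N)"
      using v unfolding fa affine_def by simp
    then show ?thesis using f(3)[OF v(1)] unfolding lift_def by simp
  qed
  from e show ?thesis
  proof
    assume e: "e = 1"
    have "\<not> n dvd k" using f(2) affine_id fa e n(1) by blast
    then show ?thesis using inv e unfolding rotational_def by (auto simp: add.commute)
  next
    assume "e = - 1"
    then show ?thesis using inv unfolding reflective_def by auto
  qed
qed

end

text \<open>If no extension of \<open>c\<close> is distinguishing, the periodic predicates that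
  agree with \<open>lift n c\<close> outside \<open>W\<close> form a symmetric cube, which
  contradicts \<open>C_empty\<close>.\<close>

lemma extends_two_colors:
  assumes rough: "seven_rough (int n)" and n: "n > 0"
    and W: "W \<subseteq> {0..<n}" "4 \<le> card W" and c: "c \<in> {0..<n} - W \<rightarrow> {1..2}"
  shows "\<exists>d \<in> {0..<n} \<rightarrow> {1..2::nat}. (\<forall>v \<in> {0..<n} - W. d v = c v) \<and>
    distinguishing (cycle_verts n) (cycle_edges n) d"
proof (rule ccontr)
  assume no: "\<not> ?thesis"
  interpret seven_rough "int n" by fact
  define C where "C = {g. periodic g \<and> (\<forall>x. nat (x mod int n) \<notin> W \<longrightarrow> g x = lift n c x)}"
  interpret symmetric_cube "int n" C "int ` W"
  proof
    fix g assume g: "g \<in> C"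
    then show "periodic g" unfolding C_def by blast
    \<comment> \<open>Reading true as color 1 and false as color 2 on \<open>W\<close> turns
      \<open>g\<close> into an extension of \<open>c\<close> whose lift is \<open>g\<close>.\<close>
    define d where "d v = (if v \<in> W then if g (int v) then 1 else 2 else c v)" for v
    have "c v \<in> {1..2}" if "v \<in> {0..<n} - W" for v using c that by blast
    then have "d \<in> {0..<n} \<rightarrow> {1..2}" "\<forall>v \<in> {0..<n} - W. d v = c v"
      unfolding d_def by auto
    then have "rotational (lift n d) \<or> reflective (lift n d)"
      using no rotational_or_reflective_lift[OF refl n] by blast
    moreover have "lift n d = g"
    proof
      fix x
      have "int n dvd x mod int n - x" by (simp flip: mod_eq_dvd_iff)
      then have "g (x mod int n) = g x"
        using g unfolding C_def periodic_def by blast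
      then show "lift n d x = g x"
        using g n unfolding C_def lift_def d_def by auto
    qed
    ultimately show "rotational g \<or> reflective g" by simp
    fix w assume "w \<in> int ` W"
    then obtain v where v: "v \<in> W" "w = int v" by blast
    have "nat (x mod int n) \<in> W" if "int n dvd x - w" for x
      using nat_mod_eq[of n v x] that v W(1) by (auto simp: dvd_diff_commute)
    then show "flip g w \<in> C"
      using g periodic_flip unfolding C_def by (auto simp: flip_def)
  next
    show "finite (int ` W)" using W(1) finite_subset by blast
    show "4 \<le> card (int ` W)" using W(2) by (simp add: card_image)
    fix w w' assume w: "w \<in> int ` W" "w' \<in> int ` W" "int n dvd w - w'"
    then obtain u v where uv: "u \<in> W" "v \<in> W" "w = int u" "w' = int v" by blast
    then have "u < n" "v < n" using W(1) by auto
    moreover have "int u mod int n = int v mod int n"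
      using w(3) uv by (simp add: mod_eq_dvd_iff)
    ultimately show "w = w'" using uv by simp
  qed
  have "periodic (lift n c)"
    unfolding periodic_def lift_def by (metis mod_eq_dvd_iff)
  then have "lift n c \<in> C" unfolding C_def by blast
  then show False using C_empty by blast
qed

section \<open>The distinguishing number and the lower bound\<close>

lemma seven_rough_least_prime_factor:
  assumes "(LEAST p. prime p \<and> p dvd n) \<ge> 7"
  shows "seven_rough (int n)"
proof
  fix j t :: int assume dvd: "int n dvd j * t" and j: "1 \<le> j" "j \<le> 6"
  have *: "coprime (int n) (int p)" if "prime p" "p < 7" for p
  proof -
    have "\<not> p dvd n"
      using Least_le[of "\<lambda>p. prime p \<and> p dvd n" p] assms that by force
    then show ?thesis
      using that(1) by (metis coprime_commute coprime_int_iff prime_imp_coprime)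
  qed
  have "prime (2::nat)" "prime (3::nat)" "prime (5::nat)" by (simp_all add: prime_nat_numeral_eq)
  then have p: "coprime (int n) 2" "coprime (int n) 3" "coprime (int n) 5"
    using *[of 2] *[of 3] *[of 5] by simp_all
  then have "coprime (int n) (2 * 2)" "coprime (int n) (2 * 3)"
    by (blast intro: coprime_mult_right_iff[THEN iffD2])+
  moreover have "j \<in> {1, 2, 3, 4, 5, 6}" using j by auto
  ultimately have "coprime (int n) j" using p by auto
  then show "int n dvd t" using dvd by (simp add: coprime_dvd_mult_right_iff)
qed

text \<open>Taking all vertices as \<open>W\<close> in \<open>extends_two_colors\<close> gives a
  distinguishing 2-coloring; with fewer colors the rotation by one preserves the coloring.\<close>

lemma dist_number_cycle:
  assumes "seven_rough (int n)" "n \<ge> 7"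
  shows "dist_number (cycle_verts n) (cycle_edges n) = 2"
  unfolding dist_number_def
proof (rule Least_equality)
  show "\<exists>c\<in>cycle_verts n \<rightarrow> {1..2}. distinguishing (cycle_verts n) (cycle_edges n) c"
    using extends_two_colors[of n "{0..<n}" "\<lambda>_. 1"] assms unfolding cycle_verts_def by auto
next
  fix k assume "\<exists>c\<in>cycle_verts n \<rightarrow> {1..k}. distinguishing (cycle_verts n) (cycle_edges n) c"
  then obtain c where c: "c \<in> {0..<n} \<rightarrow> {1..k}" "distinguishing (cycle_verts n) (cycle_edges n) c"
    unfolding cycle_verts_def by blast
  show "2 \<le> k"
  proof (rule ccontr)
    assume k: "\<not> 2 \<le> k"
    have c1: "c v = 1" if "v < n" for v
    proof -
      have "c v \<in> {1..k}" using c(1) that by auto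
      then show ?thesis using k by auto
    qed
    have aut: "affine n 1 1 \<in> graph_aut (cycle_verts n) (cycle_edges n)"
      using assms(2) by (intro affine_aut) auto
    have "affine n 1 1 v < n" if "v < n" for v
      using that unfolding affine_def by (simp add: nat_less_iff)
    then have "affine n 1 1 = id"
      using aut c(2) c1 unfolding distinguishing_def cycle_verts_def by auto
    then have "affine n 1 1 0 = 0" by simp
    then show False using assms(2) by (simp add: affine_def)
  qed
qed

text \<open>Fixing 0 and 1 forces \<open>k\<close> to vanish modulo \<open>n\<close> and
  \<open>e = 1\<close>; the vertex 2 raises the size to the 3 that the lower bound calls
  for.\<close>

lemma fixing_set_012:
  assumes "n \<ge> 3"
  shows "fixing_set (cycle_verts n) (cycle_edges n) {0, 1, 2}"
  unfolding fixing_set_def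
proof (intro conjI ballI impI)
  show "{0, 1, 2} \<subseteq> cycle_verts n" using assms unfolding cycle_verts_def by auto
  fix f assume f: "f \<in> graph_aut (cycle_verts n) (cycle_edges n)" "f \<noteq> id"
  obtain k e where e: "e = 1 \<or> e = - 1" and fa: "f = affine n k e"
    using aut_affine[OF f(1)] assms by auto
  show "\<exists>v\<in>{0, 1, 2}. f v \<noteq> v"
  proof (rule ccontr)
    assume "\<not> ?thesis"
    then have "affine n k e 0 = 0" "affine n k e 1 = 1" using fa by auto
    then have "k mod int n = 0" and ke: "(k + e) mod int n = 1"
      using assms pos_mod_sign[of "int n" k]
      by (auto simp: affine_def nat_eq_iff split: if_splits)
    then have k: "int n dvd k" by auto
    moreover have "int n dvd k + e - 1"
      using ke assms by (simp flip: mod_eq_dvd_iff)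
    ultimately have "int n dvd e - 1" by algebra
    with e have "e = 1" using assms zdvd_imp_le[of "int n" 2] by auto
    then show False using affine_id[OF k] f(2) fa by blast
  qed
qed

text \<open>The reflection \<open>k - v\<close> maps \<open>0..k\<close> and the remaining vertices
  each to themselves. It preserves \<open>d\<close> if the colors on \<open>0..k\<close> form a
  palindrome and all others are 1.\<close>

lemma not_distinguishing_012:
  assumes n: "n \<ge> 7" and d: "d \<in> {0..<n} \<rightarrow> {1..2::nat}" "\<And>v. 3 \<le> v \<Longrightarrow> v < n \<Longrightarrow> d v = 1"
  shows "\<not> distinguishing (cycle_verts n) (cycle_edges n) d"
proof
  assume dist: "distinguishing (cycle_verts n) (cycle_edges n) d"
  have d12: "d v = 1 \<or> d v = 2" if "v < n" for v
  proof -
    have "d v \<in> {1..2}" using d(1) that by auto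
    then show ?thesis by auto
  qed
  have d34: "d 3 = 1" "d 4 = 1" using d(2) n by auto
  obtain k where k: "k \<le> 4" "\<And>v. k < v \<Longrightarrow> v < n \<Longrightarrow> d v = 1" "\<And>v. v \<le> k \<Longrightarrow> d (k - v) = d v"
  proof -
    have upto: "v \<in> {0, 1, 2, 3, 4}" if "v \<le> 4" for v :: nat using that by auto
    have tail: "d v = 1" if "k < v" "v < n" "\<forall>i\<in>{1, 2}. k < i \<longrightarrow> d i = 1" for v k
      using that d(2)[of v] by (cases "v = 1 \<or> v = 2") auto
    \<comment> \<open>The palindromes are \<open>aba\<close> for 2, \<open>11211\<close> for 4,
      \<open>22\<close> for 1, \<open>2\<close> for 0 and \<open>1221\<close> for 3; the longer ones
      use vertices 3 and 4 of color 1.\<close>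
    define k :: nat where "k = (if d 0 = d 2 then 2 else if d 1 = d 0 then if d 0 = 1 then 4 else 1
      else if d 2 = 1 then 0 else 3)"
    have "k \<le> 4" unfolding k_def by auto
    moreover have "\<forall>i\<in>{1, 2}. k < i \<longrightarrow> d i = 1"
      using d12[of 0] d12[of 1] d12[of 2] n unfolding k_def by auto
    moreover have "d (k - v) = d v" if "v \<le> k" for v
      using upto[of v] that \<open>k \<le> 4\<close> d12[of 0] d12[of 1] d12[of 2] n d34 unfolding k_def
      by (auto split: if_splits)
    ultimately show thesis using that tail by blast
  qed
  let ?f = "affine n (int k) (- 1)"
  have f: "?f v = (if v \<le> k then k - v else n + k - v)" if "v < n" for v
    using that k(1) n nat_mod_eq[of n "if v \<le> k then k - v else n + k - v" "int k - int v"]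
    by (auto simp: affine_def of_nat_diff)
  have "d (?f v) = d v" if "v < n" for v
    using that k(2)[of v] k(2)[of "n + k - v"] k(3)[of v] by (auto simp: f)
  moreover have "?f \<in> graph_aut (cycle_verts n) (cycle_edges n)"
    using n by (intro affine_aut) auto
  ultimately have "?f = id"
    using dist unfolding distinguishing_def cycle_verts_def by auto
  then have "?f 0 = 0" "?f 1 = 1" by simp_all
  then show False using f[of 0] f[of 1] n by (auto split: if_splits)
qed

theorem theorem6:
  fixes n :: nat
  assumes "n \<ge> 3"
    and "(LEAST p. prime p \<and> p dvd n) \<ge> 7"
  shows "ext_D (cycle_verts n) (cycle_edges n) = 4"
proof -
  have rough: "seven_rough (int n)" using assms(2) by (rule seven_rough_least_prime_factor)
  have n: "n \<ge> 7"
  proof (rule ccontr)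
    assume "\<not> n \<ge> 7"
    \<comment> \<open>For \<open>n\<close> below 7 the multiplier \<open>j = n\<close> itself is
      admissible in \<open>torsion\<close>.\<close>
    then have "int n dvd 1"
      using seven_rough.torsion[OF rough, of "int n" 1] assms(1) by simp
    then show False using assms(1) by simp
  qed
  have "n > 0" using n by simp
  note dist = dist_number_cycle[OF rough n]
  show ?thesis
    unfolding ext_D_def
  proof (rule Least_equality)
    show "\<forall>W. fixing_set (cycle_verts n) (cycle_edges n) W \<and> 4 \<le> card W \<longrightarrow>
        extends_distinguishing (cycle_verts n) (cycle_edges n) W"
      using extends_two_colors[OF rough, folded cycle_verts_def] \<open>n > 0\<close>
      unfolding extends_distinguishing_def dist fixing_set_def by blast
  next
    fix m assume m: "\<forall>W. fixing_set (cycle_verts n) (cycle_edges n) W \<and> m \<le> card W \<longrightarrow>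
        extends_distinguishing (cycle_verts n) (cycle_edges n) W"
    show "4 \<le> m"
    proof (rule ccontr)
      assume "\<not> 4 \<le> m"
      then have "extends_distinguishing (cycle_verts n) (cycle_edges n) {0, 1, 2}"
        using m fixing_set_012[OF assms(1)] by simp
      then have "\<forall>c \<in> cycle_verts n - {0, 1, 2} \<rightarrow> {1..2}. \<exists>d \<in> cycle_verts n \<rightarrow> {1..2}.
          (\<forall>v \<in> cycle_verts n - {0, 1, 2}. d v = c v) \<and>
          distinguishing (cycle_verts n) (cycle_edges n) d"
        unfolding extends_distinguishing_def dist .
      from bspec[OF this, of "\<lambda>_. 1"] obtain d where d: "d \<in> cycle_verts n \<rightarrow> {1..2}"
          "\<forall>v \<in> cycle_verts n - {0, 1, 2}. d v = 1"
          "distinguishing (cycle_verts n) (cycle_edges n) d"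
        by auto
      have "d v = 1" if "3 \<le> v" "v < n" for v
        using d(2) that unfolding cycle_verts_def by auto
      then show False
        using not_distinguishing_012[OF n, folded cycle_verts_def] d(1,3) by blast
    qed
  qed
qed

end
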